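(* Let $\Omega\subset\mathbb{R}^2$ be open and bounded, $\mathcal{H}=L^2(\Omega,\mathbb{R}^2)$, and $$\tilde J(u):=\int_\Omega|\mathrm{rot}\,u|:=\sup\Big\{\int_\Omega u\cdot\nabla^\perp v\,\mathrm{d}x : v\in C_c^\infty(\Omega,[-1,1])\Big\},\quad u\in L^2(\Omega,\mathbb{R}^2),$$ where $\nabla^\perp=(\partial_2,-\partial_1)^T$. Then the gradient flow $\partial_tu(t)=-p(t)$, $p(t)\in\partial\tilde J(u(t))$ with $u(0)=f$ generates a sequence of eigenvectors $p(t)$ for $t>0$, i.e. $p(t)\in\partial\tilde J(p(t))$ for all $t>0$.
   Context: For a functional $J$ on $\mathcal{H}$, the subdifferential is $\partial J(u)=\{p\in\mathcal{H}:\langle p,v\rangle\le J(v)\ \forall v\in\mathcal{H},\ \langle p,u\rangle=J(u)\}$, with $\langle\cdot,\cdot\rangle$ the $L^2$ inner product, and $\mathrm{dom}(\partial J)=\{u:\partial J(u)\ne\emptyset\}$. $C_c^\infty(\Omega,[-1,1])$ is the set of smooth compactly supported functions on $\Omega$ with values in $[-1,1]$. Gradient flow of $J$ (here applied with $J=\tilde J$): for $f\in\overline{\mathrm{dom}(\partial J)}$, the solution $(u,p)$ of $\partial_tu(t)=-p(t)$, $p(t)\in\partial J(u(t))$, $u(0)=f$ is the unique continuous $u:[0,\infty)\to\mathcal{H}$ with $u(0)=f$ given by Brezis' theory (Lipschitz on $[\delta,\infty)$ for every $\delta>0$, $u(t)\in\mathrm{dom}(\partial J)$ for all $t>0$, right-differentiable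 at every $t>0$), together with $p(t):=-\partial_t^+u(t)$, which is the element of minimal norm in $\partial J(u(t))$ for every $t>0$. *)

theory Defs
  imports "HOL-Analysis.Analysis"
begin

text \<open>
  Elements of \<open>L\<^sup>2(\<Omega>, \<real>\<^sup>2)\<close> are represented by functions that are square integrable on
  \<open>\<Omega>\<close>; their values off \<open>\<Omega>\<close> play no role. No quotient is formed: equality in
  \<open>L\<^sup>2\<close> is equality almost everywhere on \<open>\<Omega>\<close>, and limits are taken in the seminorm
  \<open>l2_norm \<Omega>\<close>.
\<close>

definition L2 :: "(real^2) set \<Rightarrow> (real^2 \<Rightarrow> real^2) set" where
  "L2 \<Omega> = {u. u \<in> borel_measurable (lebesgue_on \<Omega>) \<and>
               integrable (lebesgue_on \<Omega>) (\<lambda>x. (norm (u x))\<^sup>2)}"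

definition l2_inner :: "(real^2) set \<Rightarrow> (real^2 \<Rightarrow> real^2) \<Rightarrow> (real^2 \<Rightarrow> real^2) \<Rightarrow> real" where
  "l2_inner \<Omega> u v = (\<integral>x. u x \<bullet> v x \<partial>lebesgue_on \<Omega>)"

definition l2_norm :: "(real^2) set \<Rightarrow> (real^2 \<Rightarrow> real^2) \<Rightarrow> real" where
  "l2_norm \<Omega> u = sqrt (l2_inner \<Omega> u u)"

definition partial_deriv :: "2 \<Rightarrow> (real^2 \<Rightarrow> real) \<Rightarrow> real^2 \<Rightarrow> real" where
  "partial_deriv i v x = frechet_derivative v (at x) (axis i 1)"

fun Ck :: "nat \<Rightarrow> (real^2 \<Rightarrow> real) \<Rightarrow> bool" where
  "Ck 0 v \<longleftrightarrow> continuous_on UNIV v"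
| "Ck (Suc k) v \<longleftrightarrow> (\<forall>x. v differentiable (at x)) \<and> (\<forall>i. Ck k (partial_deriv i v))"

text \<open>
  A smooth function with compact support in \<open>\<Omega>\<close> is identified with its extension by zero,
  which is smooth on the whole plane.
\<close>

definition test_functions :: "(real^2) set \<Rightarrow> (real^2 \<Rightarrow> real) set" where
  "test_functions \<Omega> = {v. (\<forall>k. Ck k v) \<and> compact (closure {x. v x \<noteq> 0}) \<and>
                          closure {x. v x \<noteq> 0} \<subseteq> \<Omega> \<and> range v \<subseteq> {-1..1}}"

definition grad_perp :: "(real^2 \<Rightarrow> real) \<Rightarrow> real^2 \<Rightarrow> real^2" where
  "grad_perp v x = vector [partial_deriv 2 v x, - partial_deriv 1 v x]"

definition J_rot :: "(real^2) set \<Rightarrow> (real^2 \<Rightarrow> real^2) \<Rightarrow> ereal" where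
  "J_rot \<Omega> u = (SUP v\<in>test_functions \<Omega>. ereal (l2_inner \<Omega> u (grad_perp v)))"

definition subdiff ::
  "(real^2) set \<Rightarrow> ((real^2 \<Rightarrow> real^2) \<Rightarrow> ereal) \<Rightarrow> (real^2 \<Rightarrow> real^2) \<Rightarrow> (real^2 \<Rightarrow> real^2) set" where
  "subdiff \<Omega> J u = {p \<in> L2 \<Omega>. (\<forall>v\<in>L2 \<Omega>. ereal (l2_inner \<Omega> p v) \<le> J v) \<and>
                               ereal (l2_inner \<Omega> p u) = J u}"

definition dom_subdiff ::
  "(real^2) set \<Rightarrow> ((real^2 \<Rightarrow> real^2) \<Rightarrow> ereal) \<Rightarrow> (real^2 \<Rightarrow> real^2) set" where
  "dom_subdiff \<Omega> J = {u \<in> L2 \<Omega>. subdiff \<Omega> J u \<noteq> {}}"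

definition l2_closure :: "(real^2) set \<Rightarrow> (real^2 \<Rightarrow> real^2) set \<Rightarrow> (real^2 \<Rightarrow> real^2) set" where
  "l2_closure \<Omega> S = {f \<in> L2 \<Omega>. \<forall>\<epsilon>>0. \<exists>g\<in>S. l2_norm \<Omega> (\<lambda>x. f x - g x) < \<epsilon>}"

text \<open>
  \<open>gradient_flow \<Omega> J f u p\<close> says that \<open>(u, p)\<close> is the solution, in the sense of Brezis, of
  \<open>\<partial>\<^sub>t u = -p\<close>, \<open>p \<in> \<partial>J(u)\<close>, \<open>u(0) = f\<close>. The clauses are, in order: \<open>u\<close> maps
  \<open>[0,\<infinity>)\<close> into \<open>L\<^sup>2\<close>, it is continuous, it has initial value \<open>f\<close>, it is Lipschitz on
  \<open>[\<delta>,\<infinity>)\<close> for all \<open>\<delta> > 0\<close>, \<open>u(t) \<in> dom(\<partial>J)\<close> for \<open>t > 0\<close>, \<open>-p(t)\<close> is the right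
  derivative of \<open>u\<close> at each \<open>t > 0\<close>, and \<open>p(t)\<close> has minimal norm in \<open>\<partial>J(u(t))\<close>.
  Only \<open>u(t)\<close> for \<open>t \<ge> 0\<close> and \<open>p(t)\<close> for \<open>t > 0\<close> matter.
\<close>

definition gradient_flow ::
  "(real^2) set \<Rightarrow> ((real^2 \<Rightarrow> real^2) \<Rightarrow> ereal) \<Rightarrow> (real^2 \<Rightarrow> real^2) \<Rightarrow>
   (real \<Rightarrow> real^2 \<Rightarrow> real^2) \<Rightarrow> (real \<Rightarrow> real^2 \<Rightarrow> real^2) \<Rightarrow> bool" where
  "gradient_flow \<Omega> J f u p \<longleftrightarrow>
     (\<forall>t\<ge>0. u t \<in> L2 \<Omega>) \<and>
     (\<forall>t\<ge>0. ((\<lambda>s. l2_norm \<Omega> (\<lambda>x. u s x - u t x)) \<longlongrightarrow> 0) (at t within {0..})) \<and>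
     (AE x in lebesgue_on \<Omega>. u 0 x = f x) \<and>
     (\<forall>\<delta>>0. \<exists>L. \<forall>s\<ge>\<delta>. \<forall>t\<ge>\<delta>. l2_norm \<Omega> (\<lambda>x. u s x - u t x) \<le> L * \<bar>s - t\<bar>) \<and>
     (\<forall>t>0. u t \<in> dom_subdiff \<Omega> J) \<and>
     (\<forall>t>0. ((\<lambda>h. l2_norm \<Omega> (\<lambda>x. (u (t + h) x - u t x) /\<^sub>R h - (- p t x))) \<longlongrightarrow> 0) (at_right 0)) \<and>
     (\<forall>t>0. p t \<in> subdiff \<Omega> J (u t) \<and>
             (\<forall>q\<in>subdiff \<Omega> J (u t). l2_norm \<Omega> (p t) \<le> l2_norm \<Omega> q))"

end

theory Submission
  imports Defs
begin

text \<open>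
  The flow enters through the minimality of its velocity: at each time \<open>t > 0\<close>, \<open>p t\<close> is an element of
  minimal norm in the subdifferential at \<open>u t\<close>. What has to be shown is a statement about a single
  field \<open>u\<close>: if \<open>p\<close> has minimal norm in the subdifferential of \<open>J_rot\<close> at \<open>u\<close>, then \<open>\<langle>p, grad_perp w\<rangle> \<le> \<langle>p, p\<rangle>\<close> for all test
  functions \<open>w\<close>. Taking the supremum over \<open>w\<close> gives \<open>J_rot p \<le> \<langle>p, p\<rangle>\<close>, and the opposite inequality
  holds because \<open>p\<close>, being a subgradient, is dominated by \<open>J_rot\<close>. Hence \<open>p\<close> is a subgradient at itself.

  The reason for the inequality is a truncation. Formally \<open>p = \<nabla>\<^sup>\<bottom>v\<close>, where \<open>\<bar>v\<bar> \<le> 1\<close>, \<open>v = 1\<close> on the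
  positive part of the measure \<open>rot u\<close> and \<open>v = -1\<close> on its negative part; among all such functions
  \<open>v\<close> has minimal Dirichlet energy. For \<open>e > 0\<close> the function \<open>v + e * (v - w)\<close> is at least \<open>1\<close> where
  \<open>v = 1\<close> and at most \<open>-1\<close> where \<open>v = -1\<close>. Its truncation to \<open>[-1, 1]\<close> therefore is again a competitor,
  and truncation does not increase the energy. So \<open>v\<close> has no larger energy than \<open>v + e * (v - w)\<close>,
  and letting \<open>e\<close> tend to \<open>0\<close> yields \<open>\<langle>p, p - \<nabla>\<^sup>\<bottom>w\<rangle> \<ge> 0\<close>.

  The proof below carries this out with test functions only, so that neither Sobolev functions nor
  their values on small sets enter. A field dominated by \<open>J_rot\<close> is an \<open>L\<^sup>2\<close> limit of fields
  \<open>grad_perp v\<close> (\<open>approx_by_grad_perp\<close>). That the truncated functions nearly maximize the pairing with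
  \<open>u\<close> follows from a pointwise inequality (\<open>soft_clip_approx\<close>) and the boundedness of the pairing in the
  supremum norm (\<open>J_rot_bound\<close>). The passage to the limit in the minimality of \<open>p\<close> uses, instead of
  weak compactness, that nearly norm-minimal elements of nested convex sets converge strongly
  (\<open>nested_convex_minimizer\<close>). \<open>minimal_subgradient_eigenvector\<close> combines these.
\<close>

section \<open>The semi-inner product on square integrable fields\<close>

lemma L2_D:
  assumes "u \<in> L2 \<Omega>"
  shows "u \<in> borel_measurable (lebesgue_on \<Omega>)" "integrable (lebesgue_on \<Omega>) (\<lambda>x. (norm (u x))\<^sup>2)"
  using assms by (auto simp: L2_def)

lemma L2_integrable_inner:
  assumes "u \<in> L2 \<Omega>" "v \<in> L2 \<Omega>"
  shows "integrable (lebesgue_on \<Omega>) (\<lambda>x. u x \<bullet> v x)"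
proof (rule Bochner_Integration.integrable_bound)
  show "integrable (lebesgue_on \<Omega>) (\<lambda>x. (norm (u x))\<^sup>2 + (norm (v x))\<^sup>2)"
    using assms by (auto dest: L2_D)
  show "(\<lambda>x. u x \<bullet> v x) \<in> borel_measurable (lebesgue_on \<Omega>)"
    using L2_D(1)[OF assms(1)] L2_D(1)[OF assms(2)] by measurable
  have "\<bar>u x \<bullet> v x\<bar> \<le> (norm (u x))\<^sup>2 + (norm (v x))\<^sup>2" for x
  proof -
    have "\<bar>u x \<bullet> v x\<bar> \<le> norm (u x) * norm (v x)"
      by (rule Cauchy_Schwarz_ineq2)
    also have "\<dots> \<le> (norm (u x))\<^sup>2 + (norm (v x))\<^sup>2"
      using sum_squares_bound[of "norm (u x)" "norm (v x)"]
        mult_nonneg_nonneg[OF norm_ge_zero[of "u x"] norm_ge_zero[of "v x"]] by linarith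
    finally show ?thesis .
  qed
  then show "AE x in lebesgue_on \<Omega>. norm (u x \<bullet> v x) \<le> norm ((norm (u x))\<^sup>2 + (norm (v x))\<^sup>2)"
    by auto
qed

lemma L2_scaleR:
  assumes "u \<in> L2 \<Omega>"
  shows "(\<lambda>x. a *\<^sub>R u x) \<in> L2 \<Omega>"
  using assms by (auto simp: L2_def power_mult_distrib)

lemma L2_add:
  assumes "u \<in> L2 \<Omega>" "v \<in> L2 \<Omega>"
  shows "(\<lambda>x. u x + v x) \<in> L2 \<Omega>"
proof -
  have "integrable (lebesgue_on \<Omega>) (\<lambda>x. (norm (u x))\<^sup>2 + (norm (v x))\<^sup>2 + 2 * (u x \<bullet> v x))"
    by (intro Bochner_Integration.integrable_add integrable_mult_right L2_D(2) L2_integrable_inner assms)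
  moreover have "(norm (u x + v x))\<^sup>2 = (norm (u x))\<^sup>2 + (norm (v x))\<^sup>2 + 2 * (u x \<bullet> v x)" for x
    by (simp add: power2_norm_eq_inner inner_add_left inner_add_right inner_commute)
  ultimately show ?thesis
    using assms by (auto simp: L2_def)
qed

lemma L2_diff:
  assumes "u \<in> L2 \<Omega>" "v \<in> L2 \<Omega>"
  shows "(\<lambda>x. u x - v x) \<in> L2 \<Omega>"
  using L2_add[OF assms(1) L2_scaleR[OF assms(2), of "-1"]] by simp

lemma L2_minus:
  assumes "u \<in> L2 \<Omega>"
  shows "(\<lambda>x. - u x) \<in> L2 \<Omega>"
  using L2_scaleR[OF assms, of "-1"] by simp

lemmas L2_intros = L2_scaleR L2_add L2_diff L2_minus

lemma l2_inner_commute: "l2_inner \<Omega> u v = l2_inner \<Omega> v u"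
  by (simp add: l2_inner_def inner_commute)

lemma l2_inner_scaleR_left: "l2_inner \<Omega> (\<lambda>x. a *\<^sub>R u x) w = a * l2_inner \<Omega> u w"
  by (simp add: l2_inner_def)

lemma l2_inner_minus_left: "l2_inner \<Omega> (\<lambda>x. - u x) w = - l2_inner \<Omega> u w"
  by (simp add: l2_inner_def)

lemma l2_inner_add_left:
  assumes "u \<in> L2 \<Omega>" "v \<in> L2 \<Omega>" "w \<in> L2 \<Omega>"
  shows "l2_inner \<Omega> (\<lambda>x. u x + v x) w = l2_inner \<Omega> u w + l2_inner \<Omega> v w"
  using assms by (simp add: l2_inner_def inner_add_left L2_integrable_inner)

lemma l2_inner_diff_left:
  assumes "u \<in> L2 \<Omega>" "v \<in> L2 \<Omega>" "w \<in> L2 \<Omega>"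
  shows "l2_inner \<Omega> (\<lambda>x. u x - v x) w = l2_inner \<Omega> u w - l2_inner \<Omega> v w"
  using assms by (simp add: l2_inner_def inner_diff_left L2_integrable_inner)

lemma l2_inner_scaleR_right: "l2_inner \<Omega> w (\<lambda>x. a *\<^sub>R u x) = a * l2_inner \<Omega> w u"
  by (simp add: l2_inner_def)

lemma l2_inner_minus_right: "l2_inner \<Omega> w (\<lambda>x. - u x) = - l2_inner \<Omega> w u"
  by (simp add: l2_inner_def)

lemma l2_inner_add_right:
  assumes "u \<in> L2 \<Omega>" "v \<in> L2 \<Omega>" "w \<in> L2 \<Omega>"
  shows "l2_inner \<Omega> w (\<lambda>x. u x + v x) = l2_inner \<Omega> w u + l2_inner \<Omega> w v"
  using assms by (simp add: l2_inner_def inner_add_right L2_integrable_inner)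

lemma l2_inner_diff_right:
  assumes "u \<in> L2 \<Omega>" "v \<in> L2 \<Omega>" "w \<in> L2 \<Omega>"
  shows "l2_inner \<Omega> w (\<lambda>x. u x - v x) = l2_inner \<Omega> w u - l2_inner \<Omega> w v"
  using assms by (simp add: l2_inner_def inner_diff_right L2_integrable_inner)

lemmas l2_inner_linear =
  l2_inner_scaleR_left l2_inner_minus_left l2_inner_add_left l2_inner_diff_left
  l2_inner_scaleR_right l2_inner_minus_right l2_inner_add_right l2_inner_diff_right

lemma l2_inner_self_nonneg: "0 \<le> l2_inner \<Omega> u u"
  by (simp add: l2_inner_def)

lemma l2_norm_nonneg: "0 \<le> l2_norm \<Omega> u"
  by (simp add: l2_norm_def l2_inner_self_nonneg)

lemma l2_norm_power2: "(l2_norm \<Omega> u)\<^sup>2 = l2_inner \<Omega> u u"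
  by (simp add: l2_norm_def l2_inner_self_nonneg)

lemma l2_norm_scaleR: "l2_norm \<Omega> (\<lambda>x. a *\<^sub>R u x) = \<bar>a\<bar> * l2_norm \<Omega> u"
  by (simp add: l2_norm_def l2_inner_def real_sqrt_mult flip: mult.assoc)

lemma l2_norm_minus_commute: "l2_norm \<Omega> (\<lambda>x. u x - v x) = l2_norm \<Omega> (\<lambda>x. v x - u x)"
  using l2_norm_scaleR[of \<Omega> "-1" "\<lambda>x. u x - v x"] by simp

lemma l2_norm_le_pointwise:
  assumes "u \<in> L2 \<Omega>" "v \<in> L2 \<Omega>" "\<And>x. norm (u x) \<le> norm (v x)"
  shows "l2_norm \<Omega> u \<le> l2_norm \<Omega> v"
  unfolding l2_norm_def l2_inner_def
proof (intro real_sqrt_le_mono integral_mono L2_integrable_inner assms)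
  show "u x \<bullet> u x \<le> v x \<bullet> v x" for x
    using assms(3)[of x] by (simp add: norm_le)
qed

lemma l2_norm_add_scaleR_power2:
  assumes "g \<in> L2 \<Omega>" "h \<in> L2 \<Omega>"
  shows "(l2_norm \<Omega> (\<lambda>x. g x + t *\<^sub>R h x))\<^sup>2
    = (l2_norm \<Omega> g)\<^sup>2 + 2 * t * l2_inner \<Omega> g h + t\<^sup>2 * (l2_norm \<Omega> h)\<^sup>2"
  unfolding l2_norm_power2 using assms l2_inner_commute[of \<Omega> g h]
  by (simp add: l2_inner_linear L2_intros algebra_simps power2_eq_square)

text \<open>
  The norms are enlarged by \<open>d > 0\<close> so that one may divide by them; this covers the case where
  \<open>l2_norm\<close>, which is only a seminorm on functions, vanishes on one of the arguments.
\<close>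

lemma l2_Cauchy_Schwarz:
  assumes "g \<in> L2 \<Omega>" "h \<in> L2 \<Omega>"
  shows "\<bar>l2_inner \<Omega> g h\<bar> \<le> l2_norm \<Omega> g * l2_norm \<Omega> h"
proof -
  let ?a = "l2_norm \<Omega> g" and ?b = "l2_norm \<Omega> h" and ?i = "l2_inner \<Omega> g h"
  have "s * ?i \<le> (?a + d) * (?b + d)" if d: "0 < d" and s: "s\<^sup>2 = 1" for s d
  proof -
    define \<alpha> \<beta> where "\<alpha> = ?a + d" and "\<beta> = ?b + d"
    have pos: "0 < \<alpha>" "0 < \<beta>" and le: "?a\<^sup>2 \<le> \<alpha>\<^sup>2" "?b\<^sup>2 \<le> \<beta>\<^sup>2"
      using d l2_norm_nonneg[of \<Omega> g] l2_norm_nonneg[of \<Omega> h]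
      by (auto simp: \<alpha>_def \<beta>_def intro!: power_mono add_nonneg_pos)
    have "0 \<le> (l2_norm \<Omega> (\<lambda>x. g x + (- s * (\<alpha> / \<beta>)) *\<^sub>R h x))\<^sup>2"
      by simp
    also have "\<dots> = ?a\<^sup>2 - 2 * (s * ?i) * (\<alpha> / \<beta>) + s\<^sup>2 * (\<alpha> / \<beta>)\<^sup>2 * ?b\<^sup>2"
      unfolding l2_norm_add_scaleR_power2[OF assms] by (simp add: power_mult_distrib power_divide)
    also have "\<dots> \<le> \<alpha>\<^sup>2 - 2 * (s * ?i) * (\<alpha> / \<beta>) + (\<alpha> / \<beta>)\<^sup>2 * \<beta>\<^sup>2"
      using le s by (intro add_mono diff_mono order_refl) (auto intro: mult_left_mono)
    also have "\<dots> = 2 * (\<alpha> / \<beta>) * (\<alpha> * \<beta> - s * ?i)"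
      using pos by (simp add: field_simps power2_eq_square)
    finally have "0 \<le> \<alpha> * \<beta> - s * ?i"
      using pos by (simp add: zero_le_mult_iff zero_le_divide_iff)
    then show ?thesis by (simp add: \<alpha>_def \<beta>_def)
  qed
  from this[of _ 1] this[of _ "-1"] have "\<bar>?i\<bar> \<le> (?a + d) * (?b + d)" if "0 < d" for d
    using that by (simp add: abs_le_iff)
  moreover have "((\<lambda>d. (?a + d) * (?b + d)) \<longlongrightarrow> ?a * ?b) (at_right 0)"
    by (auto intro!: tendsto_eq_intros)
  ultimately show ?thesis
    by (intro tendsto_lowerbound[of _ _ "at_right (0::real)"])
      (auto simp: eventually_at_right_less intro: eventually_mono[OF eventually_at_right_less])
qed

lemma l2_norm_triangle:
  assumes "g \<in> L2 \<Omega>" "h \<in> L2 \<Omega>"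
  shows "l2_norm \<Omega> (\<lambda>x. g x + h x) \<le> l2_norm \<Omega> g + l2_norm \<Omega> h"
proof (rule power2_le_imp_le)
  have "(l2_norm \<Omega> (\<lambda>x. g x + h x))\<^sup>2
      = (l2_norm \<Omega> g)\<^sup>2 + 2 * l2_inner \<Omega> g h + (l2_norm \<Omega> h)\<^sup>2"
    using l2_norm_add_scaleR_power2[OF assms, of 1] by simp
  also have "\<dots> \<le> (l2_norm \<Omega> g + l2_norm \<Omega> h)\<^sup>2"
    using l2_Cauchy_Schwarz[OF assms] by (simp add: power2_sum)
  finally show "(l2_norm \<Omega> (\<lambda>x. g x + h x))\<^sup>2 \<le> (l2_norm \<Omega> g + l2_norm \<Omega> h)\<^sup>2" .
qed (simp add: l2_norm_nonneg)

lemma l2_norm_le_add_diff: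
  assumes "g \<in> L2 \<Omega>" "h \<in> L2 \<Omega>"
  shows "l2_norm \<Omega> g \<le> l2_norm \<Omega> h + l2_norm \<Omega> (\<lambda>x. g x - h x)"
  using l2_norm_triangle[of h \<Omega> "\<lambda>x. g x - h x"] assms by (simp add: L2_diff)

lemma l2_norm_tendsto:
  assumes "\<And>n. c n \<in> L2 \<Omega>" "g \<in> L2 \<Omega>" "(\<lambda>n. l2_norm \<Omega> (\<lambda>x. c n x - g x)) \<longlonglongrightarrow> 0"
  shows "(\<lambda>n. l2_norm \<Omega> (c n)) \<longlonglongrightarrow> l2_norm \<Omega> g"
proof (rule LIM_zero_cancel, rule Lim_null_comparison[OF always_eventually assms(3)], rule allI)
  show "norm (l2_norm \<Omega> (c n) - l2_norm \<Omega> g) \<le> l2_norm \<Omega> (\<lambda>x. c n x - g x)" for n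
    using l2_norm_le_add_diff[OF assms(1,2), of n] l2_norm_le_add_diff[OF assms(2,1), of n]
      l2_norm_minus_commute[of \<Omega> g "c n"] by (simp add: abs_le_iff)
qed

lemma l2_inner_tendsto:
  assumes "\<And>n. c n \<in> L2 \<Omega>" "g \<in> L2 \<Omega>" "v \<in> L2 \<Omega>"
    "(\<lambda>n. l2_norm \<Omega> (\<lambda>x. c n x - g x)) \<longlonglongrightarrow> 0"
  shows "(\<lambda>n. l2_inner \<Omega> (c n) v) \<longlonglongrightarrow> l2_inner \<Omega> g v"
proof (rule LIM_zero_cancel, rule Lim_null_comparison[OF always_eventually], rule allI)
  show "norm (l2_inner \<Omega> (c n) v - l2_inner \<Omega> g v) \<le> l2_norm \<Omega> (\<lambda>x. c n x - g x) * l2_norm \<Omega> v" for n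
    using l2_Cauchy_Schwarz[OF L2_diff[OF assms(1,2)] assms(3), of n] assms
    by (simp add: l2_inner_diff_left)
  show "(\<lambda>n. l2_norm \<Omega> (\<lambda>x. c n x - g x) * l2_norm \<Omega> v) \<longlonglongrightarrow> 0"
    using tendsto_mult_left_zero[OF assms(4)] .
qed

text \<open>
  The first-order condition for a minimum of the norm: expand the square along the segment in
  direction \<open>h\<close>, divide by the step \<open>t\<close> and let \<open>t\<close> tend to \<open>0\<close>.
\<close>

lemma l2_inner_nonneg_of_minimal:
  assumes "g \<in> L2 \<Omega>" "h \<in> L2 \<Omega>"
    and min: "\<And>t. 0 < t \<Longrightarrow> t \<le> 1 \<Longrightarrow> l2_norm \<Omega> g \<le> l2_norm \<Omega> (\<lambda>x. g x + t *\<^sub>R h x)"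
  shows "0 \<le> l2_inner \<Omega> g h"
proof (rule tendsto_lowerbound)
  show "((\<lambda>t. l2_inner \<Omega> g h + t / 2 * (l2_norm \<Omega> h)\<^sup>2) \<longlongrightarrow> l2_inner \<Omega> g h) (at_right 0)"
    by (auto intro!: tendsto_eq_intros)
  have "0 \<le> l2_inner \<Omega> g h + t / 2 * (l2_norm \<Omega> h)\<^sup>2" if t: "0 < t" "t < 1" for t
  proof -
    have "(l2_norm \<Omega> g)\<^sup>2 \<le> (l2_norm \<Omega> (\<lambda>x. g x + t *\<^sub>R h x))\<^sup>2"
      using min[of t] t l2_norm_nonneg[of \<Omega> g] by (intro power_mono) auto
    then have "0 \<le> (2 * t) * (l2_inner \<Omega> g h + t / 2 * (l2_norm \<Omega> h)\<^sup>2)"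
      unfolding l2_norm_add_scaleR_power2[OF assms(1,2)]
      by (simp add: algebra_simps power2_eq_square)
    with t show ?thesis
      by (simp add: zero_le_mult_iff)
  qed
  then show "\<forall>\<^sub>F t in at_right 0. 0 \<le> l2_inner \<Omega> g h + t / 2 * (l2_norm \<Omega> h)\<^sup>2"
    unfolding eventually_at_right_field by (intro exI[of _ 1]) auto
qed simp

section \<open>Completeness and norm-minimal sequences\<close>

text \<open>
  Cauchy-Schwarz against a constant unit vector field, which is square integrable because the
  measure is finite.
\<close>

lemma L2_L1_bound:
  assumes "\<Omega> \<in> lmeasurable" "u \<in> L2 \<Omega>"
  shows "integrable (lebesgue_on \<Omega>) u"
    and "(\<integral>x. norm (u x) \<partial>lebesgue_on \<Omega>) \<le> l2_norm \<Omega> u * l2_norm \<Omega> (\<lambda>x. axis 1 1)"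
proof -
  interpret finite_measure "lebesgue_on \<Omega>"
    by (rule finite_measure_lebesgue_on[OF assms(1)])
  let ?b = "axis 1 1 :: real^2"
  have b: "norm ?b = 1" "?b \<bullet> ?b = 1"
    by (simp_all add: inner_axis)
  have meas: "u \<in> borel_measurable (lebesgue_on \<Omega>)"
    by (rule L2_D(1)[OF assms(2)])
  have g: "(\<lambda>x. norm (u x) *\<^sub>R ?b) \<in> L2 \<Omega>"
    using assms(2) meas by (auto simp: L2_def b)
  have h: "(\<lambda>x. ?b) \<in> L2 \<Omega>"
    by (auto simp: L2_def)
  show "integrable (lebesgue_on \<Omega>) u"
    using L2_integrable_inner[OF g h] meas by (simp add: b integrable_norm_iff)
  have "l2_norm \<Omega> (\<lambda>x. norm (u x) *\<^sub>R ?b) = l2_norm \<Omega> u"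
    by (simp add: l2_norm_def l2_inner_def b power2_norm_eq_inner flip: power2_eq_square)
  then show "(\<integral>x. norm (u x) \<partial>lebesgue_on \<Omega>) \<le> l2_norm \<Omega> u * l2_norm \<Omega> (\<lambda>x. ?b)"
    using l2_Cauchy_Schwarz[OF g h] by (simp add: l2_inner_def b)
qed

text \<open>
  The argument of Riesz and Fischer: on a set of finite measure an \<open>L\<^sup>2\<close> Cauchy sequence is also an
  \<open>L\<^sup>1\<close> Cauchy sequence, hence has an almost everywhere convergent subsequence, and Fatou's lemma
  identifies the pointwise limit as the limit in \<open>L\<^sup>2\<close>.
\<close>

lemma L2_complete:
  assumes \<Omega>: "\<Omega> \<in> lmeasurable" and c: "\<And>n. c n \<in> L2 \<Omega>"
    and Cauchy: "\<And>e. 0 < e \<Longrightarrow> \<exists>N. \<forall>i\<ge>N. \<forall>j\<ge>N. l2_norm \<Omega> (\<lambda>x. c i x - c j x) < e"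
  shows "\<exists>g\<in>L2 \<Omega>. (\<lambda>n. l2_norm \<Omega> (\<lambda>x. c n x - g x)) \<longlonglongrightarrow> 0"
proof -
  let ?M = "lebesgue_on \<Omega>"
  have meas [measurable]: "c n \<in> borel_measurable ?M" for n
    by (rule L2_D(1)[OF c])
  have L1: "\<exists>N. \<forall>i\<ge>N. \<forall>j\<ge>N. (\<integral>x. norm (c i x - c j x) \<partial>?M) < e" if "0 < e" for e
  proof -
    let ?K = "l2_norm \<Omega> (\<lambda>x. axis 1 1)"
    have K: "0 < ?K + 1"
      using l2_norm_nonneg[of \<Omega> "\<lambda>x. axis 1 1"] by linarith
    with \<open>0 < e\<close> have "0 < e / (?K + 1)"
      by simp
    from Cauchy[OF this] obtain N
      where N: "\<forall>i\<ge>N. \<forall>j\<ge>N. l2_norm \<Omega> (\<lambda>x. c i x - c j x) < e / (?K + 1)"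
      by blast
    show ?thesis
    proof (intro exI allI impI)
      fix i j assume ij: "N \<le> i" "N \<le> j"
      let ?d = "l2_norm \<Omega> (\<lambda>x. c i x - c j x)"
      have "(\<integral>x. norm (c i x - c j x) \<partial>?M) \<le> ?d * ?K"
        by (rule L2_L1_bound(2)[OF \<Omega> L2_diff[OF c c]])
      also have "\<dots> \<le> ?d * (?K + 1)"
        by (intro mult_left_mono l2_norm_nonneg) simp
      also have "\<dots> < e"
        using N ij K by (simp add: pos_less_divide_eq)
      finally show "(\<integral>x. norm (c i x - c j x) \<partial>?M) < e" .
    qed
  qed
  obtain r where r: "strict_mono r" and AE_r: "AE x in ?M. Cauchy (\<lambda>k. c (r k) x)"
    using cauchy_L1_AE_cauchy_subseq[OF L2_L1_bound(1)[OF \<Omega> c] L1] by blast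
  define g where "g x = lim (\<lambda>k. c (r k) x)" for x
  have g_meas [measurable]: "g \<in> borel_measurable ?M"
    unfolding g_def by measurable
  have AE_lim: "AE x in ?M. (\<lambda>k. c (r k) x) \<longlonglongrightarrow> g x"
    using AE_r
  proof eventually_elim
    case (elim x)
    then show ?case
      by (simp add: g_def Cauchy_convergent_iff convergent_LIMSEQ_iff)
  qed
  \<comment> \<open>Membership in \<open>L\<^sup>2\<close> is part of the claim, since a priori the limit is only measurable.\<close>
  have Fatou: "(\<lambda>x. c i x - g x) \<in> L2 \<Omega> \<and> l2_norm \<Omega> (\<lambda>x. c i x - g x) \<le> e"
    if "0 < e" and i: "\<forall>j\<ge>N. l2_norm \<Omega> (\<lambda>x. c i x - c j x) < e" for i e N
  proof -
    have int_le: "(\<integral>\<^sup>+x. ennreal ((norm (c i x - c j x))\<^sup>2) \<partial>?M) \<le> ennreal (e\<^sup>2)" if "N \<le> j" for j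
    proof -
      have "(\<integral>\<^sup>+x. ennreal ((norm (c i x - c j x))\<^sup>2) \<partial>?M)
          = ennreal ((l2_norm \<Omega> (\<lambda>x. c i x - c j x))\<^sup>2)"
        using nn_integral_eq_integral[OF L2_D(2)[OF L2_diff[OF c c]], of i j]
        by (simp add: l2_norm_power2 l2_inner_def power2_norm_eq_inner)
      also have "\<dots> \<le> ennreal (e\<^sup>2)"
        using i that by (intro ennreal_leI power_mono l2_norm_nonneg) (simp add: less_imp_le)
      finally show ?thesis .
    qed
    have "(\<integral>\<^sup>+x. ennreal ((norm (c i x - g x))\<^sup>2) \<partial>?M)
        = (\<integral>\<^sup>+x. liminf (\<lambda>k. ennreal ((norm (c i x - c (r k) x))\<^sup>2)) \<partial>?M)"
    proof (rule nn_integral_cong_AE, use AE_lim in eventually_elim)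
      fix x assume "(\<lambda>k. c (r k) x) \<longlonglongrightarrow> g x"
      then have "(\<lambda>k. ennreal ((norm (c i x - c (r k) x))\<^sup>2)) \<longlonglongrightarrow> ennreal ((norm (c i x - g x))\<^sup>2)"
        by (intro tendsto_intros)
      from lim_imp_Liminf[OF sequentially_bot this]
      show "ennreal ((norm (c i x - g x))\<^sup>2) = liminf (\<lambda>k. ennreal ((norm (c i x - c (r k) x))\<^sup>2))"
        by (rule sym)
    qed
    also have "\<dots> \<le> liminf (\<lambda>k. \<integral>\<^sup>+x. ennreal ((norm (c i x - c (r k) x))\<^sup>2) \<partial>?M)"
      by (rule nn_integral_liminf) measurable
    also have "\<dots> \<le> limsup (\<lambda>k. \<integral>\<^sup>+x. ennreal ((norm (c i x - c (r k) x))\<^sup>2) \<partial>?M)"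
      by (rule Liminf_le_Limsup) simp
    also have "\<dots> \<le> ennreal (e\<^sup>2)"
    proof (rule Limsup_bounded, rule eventually_mono[OF eventually_ge_at_top[of N]])
      fix k assume "N \<le> k"
      then show "(\<integral>\<^sup>+x. ennreal ((norm (c i x - c (r k) x))\<^sup>2) \<partial>?M) \<le> ennreal (e\<^sup>2)"
        using seq_suble[OF r, of k] by (intro int_le) linarith
    qed
    finally have le: "(\<integral>\<^sup>+x. ennreal ((norm (c i x - g x))\<^sup>2) \<partial>?M) \<le> ennreal (e\<^sup>2)" .
    then have int: "integrable ?M (\<lambda>x. (norm (c i x - g x))\<^sup>2)"
      by (intro integrableI_bounded) (auto intro: le_less_trans)
    then have L2: "(\<lambda>x. c i x - g x) \<in> L2 \<Omega>"
      by (auto simp: L2_def)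
    have "(l2_norm \<Omega> (\<lambda>x. c i x - g x))\<^sup>2 = (\<integral>x. (norm (c i x - g x))\<^sup>2 \<partial>?M)"
      by (simp add: l2_norm_power2 l2_inner_def power2_norm_eq_inner)
    also have "\<dots> \<le> e\<^sup>2"
      using le unfolding nn_integral_eq_integral[OF int, simplified] by simp
    finally have "l2_norm \<Omega> (\<lambda>x. c i x - g x) \<le> e"
      by (rule power2_le_imp_le) (use \<open>0 < e\<close> in simp)
    with L2 show ?thesis ..
  qed
  have "g \<in> L2 \<Omega>"
  proof -
    obtain N where N: "\<forall>i\<ge>N. \<forall>j\<ge>N. l2_norm \<Omega> (\<lambda>x. c i x - c j x) < 1"
      using Cauchy[of 1] by auto
    then have "(\<lambda>x. c N x - g x) \<in> L2 \<Omega>"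
      using Fatou[of 1 N N] by auto
    from L2_diff[OF c[of N] this] show ?thesis by simp
  qed
  moreover have "(\<lambda>n. l2_norm \<Omega> (\<lambda>x. c n x - g x)) \<longlonglongrightarrow> 0"
  proof (rule LIMSEQ_I)
    fix e :: real assume "0 < e"
    then obtain N where "\<forall>i\<ge>N. \<forall>j\<ge>N. l2_norm \<Omega> (\<lambda>x. c i x - c j x) < e / 2"
      using Cauchy[of "e / 2"] by auto
    then have "l2_norm \<Omega> (\<lambda>x. c i x - g x) \<le> e / 2" if "N \<le> i" for i
      using Fatou[of "e / 2" N i] that \<open>0 < e\<close> by auto
    with \<open>0 < e\<close> show "\<exists>N. \<forall>n\<ge>N. norm (l2_norm \<Omega> (\<lambda>x. c n x - g x) - 0) < e"
      by (intro exI[of _ N]) (force simp: l2_norm_nonneg)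
  qed
  ultimately show ?thesis by blast
qed

text \<open>
  Nearly norm-minimal elements of a decreasing sequence of convex sets converge: the infima of the
  norms increase to a finite limit, the midpoint of two late elements still lies in an early set,
  and the parallelogram law turns this into the Cauchy property. For a constant sequence this is
  the projection onto the closure of a convex set. For a sequence shrinking towards a set of
  maximizers it takes the place of weak compactness: from arbitrary bounded elements of the sets
  \<open>A n\<close> one obtains a norm bound on a strong limit, which is the last claim.
\<close>

lemma nested_convex_minimizer:
  fixes A :: "nat \<Rightarrow> (real^2 \<Rightarrow> real^2) set"
  assumes \<Omega>: "\<Omega> \<in> lmeasurable" and L2: "\<And>n. A n \<subseteq> L2 \<Omega>"
    and dec: "\<And>m n. m \<le> n \<Longrightarrow> A n \<subseteq> A m"
    and mid: "\<And>n a b. a \<in> A n \<Longrightarrow> b \<in> A n \<Longrightarrow> (\<lambda>x. (1 / 2) *\<^sub>R (a x + b x)) \<in> A n"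
    and bdd: "\<And>n. \<exists>a\<in>A n. l2_norm \<Omega> a \<le> B"
  obtains g c where "g \<in> L2 \<Omega>" "\<And>n. c n \<in> A n"
    "(\<lambda>n. l2_norm \<Omega> (\<lambda>x. c n x - g x)) \<longlonglongrightarrow> 0"
    "\<And>\<beta>. (\<And>n. \<exists>a\<in>A n. l2_norm \<Omega> a \<le> \<beta>) \<Longrightarrow> l2_norm \<Omega> g \<le> \<beta>"
proof -
  define d where "d n = Inf (l2_norm \<Omega> ` A n)" for n
  have bb: "bdd_below (l2_norm \<Omega> ` A n)" for n
    by (rule bdd_belowI[of _ 0]) (auto simp: l2_norm_nonneg)
  have ne: "A n \<noteq> {}" for n
    using bdd[of n] by auto
  have d_le: "d n \<le> l2_norm \<Omega> a" if "a \<in> A n" for a n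
    unfolding d_def using that bb by (intro cInf_lower) auto
  have d_nonneg: "0 \<le> d n" for n
    unfolding d_def using ne[of n] by (intro cInf_greatest) (auto simp: l2_norm_nonneg)
  have d_mono: "d m \<le> d n" if "m \<le> n" for m n
    unfolding d_def using dec[OF that] ne[of n] bb by (intro cInf_superset_mono) auto
  have d_bdd: "d n \<le> \<beta>" if "\<And>n. \<exists>a\<in>A n. l2_norm \<Omega> a \<le> \<beta>" for \<beta> n
    using that[of n] d_le by (meson order_trans)
  define D where "D = Sup (range d)"
  have bda: "bdd_above (range d)"
    using d_bdd[OF bdd] by (intro bdd_aboveI[of _ B]) auto
  have d_lim: "d \<longlonglongrightarrow> D"
    unfolding D_def using bda d_mono by (intro LIMSEQ_incseq_SUP) (auto simp: incseq_def)
  have d_le_D: "d n \<le> D" for n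
    unfolding D_def using bda by (intro cSup_upper) auto
  have "\<exists>a\<in>A n. l2_norm \<Omega> a < d n + 1 / real (Suc n)" for n
    using cInf_lessD[of "l2_norm \<Omega> ` A n" "d n + 1 / real (Suc n)"] ne[of n]
    by (auto simp: d_def)
  then obtain c where c: "\<And>n. c n \<in> A n" "\<And>n. l2_norm \<Omega> (c n) < d n + 1 / real (Suc n)"
    by metis
  have cL2: "c n \<in> L2 \<Omega>" for n
    using c(1) L2 by blast
  \<comment> \<open>By the parallelogram law, \<open>s N\<close> bounds the squared distance of any two elements after \<open>N\<close>.\<close>
  define s where "s n = 4 * (D + 1 / real (Suc n))\<^sup>2 - 4 * (d n)\<^sup>2" for n
  have s_lim: "s \<longlonglongrightarrow> 0"
  proof -
    have "s \<longlonglongrightarrow> 4 * (D + 0)\<^sup>2 - 4 * D\<^sup>2"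
      unfolding s_def by (intro tendsto_intros d_lim LIMSEQ_Suc[OF lim_1_over_n])
    then show ?thesis by simp
  qed
  have par: "(l2_norm \<Omega> (\<lambda>x. c i x - c j x))\<^sup>2 \<le> s N" if "N \<le> i" "N \<le> j" for i j N
  proof -
    have bound: "(l2_norm \<Omega> (c k))\<^sup>2 \<le> (D + 1 / real (Suc N))\<^sup>2" if "N \<le> k" for k
    proof (rule power_mono[OF _ l2_norm_nonneg])
      have "1 / real (Suc k) \<le> 1 / real (Suc N)"
        using that by (simp add: frac_le)
      then show "l2_norm \<Omega> (c k) \<le> D + 1 / real (Suc N)"
        using c(2)[of k] d_le_D[of k] by linarith
    qed
    have "(d N)\<^sup>2 \<le> (l2_norm \<Omega> (\<lambda>x. (1 / 2) *\<^sub>R (c i x + c j x)))\<^sup>2"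
    proof (rule power_mono[OF d_le d_nonneg], rule mid)
      show "c i \<in> A N" "c j \<in> A N"
        using that dec c(1) by blast+
    qed
    moreover have "4 * (l2_norm \<Omega> (\<lambda>x. (1 / 2) *\<^sub>R (c i x + c j x)))\<^sup>2
        = (l2_norm \<Omega> (\<lambda>x. c i x + c j x))\<^sup>2"
      unfolding l2_norm_scaleR by (simp add: power_mult_distrib power_divide)
    moreover have "(l2_norm \<Omega> (\<lambda>x. c i x + c j x))\<^sup>2 + (l2_norm \<Omega> (\<lambda>x. c i x - c j x))\<^sup>2
        = 2 * (l2_norm \<Omega> (c i))\<^sup>2 + 2 * (l2_norm \<Omega> (c j))\<^sup>2"
      using l2_norm_add_scaleR_power2[OF cL2 cL2, of i 1 j]
        l2_norm_add_scaleR_power2[OF cL2 cL2, of i "-1" j] by simp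
    ultimately show ?thesis
      using bound[OF that(1)] bound[OF that(2)] unfolding s_def by linarith
  qed
  have "\<exists>N. \<forall>i\<ge>N. \<forall>j\<ge>N. l2_norm \<Omega> (\<lambda>x. c i x - c j x) < e" if "0 < e" for e
  proof -
    from s_lim \<open>0 < e\<close> obtain N where N: "s N < e\<^sup>2"
      by (metis (mono_tags) eventually_sequentially order_refl order_tendstoD(2) zero_less_power)
    have "l2_norm \<Omega> (\<lambda>x. c i x - c j x) < e" if "N \<le> i" "N \<le> j" for i j
      using par[OF that] N \<open>0 < e\<close> by (intro power2_less_imp_less[of _ e]) auto
    then show ?thesis by blast
  qed
  from L2_complete[OF \<Omega> cL2 this] obtain g
    where g: "g \<in> L2 \<Omega>" "(\<lambda>n. l2_norm \<Omega> (\<lambda>x. c n x - g x)) \<longlonglongrightarrow> 0"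
    by blast
  show thesis
  proof (rule that[OF g(1) c(1) g(2)])
    fix \<beta> assume \<beta>: "\<And>n. \<exists>a\<in>A n. l2_norm \<Omega> a \<le> \<beta>"
    have "(\<lambda>n. \<beta> + 1 / real (Suc n)) \<longlonglongrightarrow> \<beta> + 0"
      by (intro tendsto_intros LIMSEQ_Suc[OF lim_1_over_n])
    moreover have "l2_norm \<Omega> (c n) \<le> \<beta> + 1 / real (Suc n)" for n
      using c(2)[of n] d_bdd[OF \<beta>, of n] by linarith
    ultimately show "l2_norm \<Omega> g \<le> \<beta>"
      using l2_norm_tendsto[OF cL2 g] by (intro LIMSEQ_le[of _ _ "\<lambda>n. \<beta> + 1 / real (Suc n)"]) auto
  qed
qed

section \<open>Calculus of smooth functions on the plane\<close>

lemma partial_deriv_eq: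
  assumes "(v has_derivative D) (at x)"
  shows "partial_deriv i v x = D (axis i 1)"
  using frechet_derivative_at[OF assms] by (simp add: partial_deriv_def)

lemma Ck_Suc_imp_Ck: "Ck (Suc k) v \<Longrightarrow> Ck k v"
proof (induction k arbitrary: v)
  case 0
  then show ?case
    by (auto intro!: continuous_at_imp_continuous_on differentiable_imp_continuous_within)
next
  case (Suc k)
  have "\<forall>x. v differentiable (at x)" "\<And>i. Ck (Suc k) (partial_deriv i v)"
    using Suc.prems by (subst (asm) Ck.simps, blast)+
  with Suc.IH show ?case by simp
qed

lemma Ck_const: "Ck k (\<lambda>x. c)"
proof (induction k arbitrary: c)
  case (Suc k)
  have "partial_deriv i (\<lambda>x. c) = (\<lambda>x. 0)" for i
    by (rule ext, subst partial_deriv_eq[OF has_derivative_const]) simp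
  with Suc show ?case by simp
qed simp

lemma partial_deriv_add:
  assumes "u differentiable (at x)" "v differentiable (at x)"
  shows "partial_deriv i (\<lambda>x. u x + v x) x = partial_deriv i u x + partial_deriv i v x"
  by (subst partial_deriv_eq[OF has_derivative_add[OF assms[unfolded frechet_derivative_works]]])
    (simp add: partial_deriv_def)

lemma partial_deriv_mult:
  assumes "u differentiable (at x)" "v differentiable (at x)"
  shows "partial_deriv i (\<lambda>x. u x * v x) x = u x * partial_deriv i v x + partial_deriv i u x * v x"
  by (subst partial_deriv_eq[OF has_derivative_mult[OF assms[unfolded frechet_derivative_works]]])
    (simp add: partial_deriv_def)

lemma partial_deriv_chain:
  assumes "u differentiable (at x)" "(F has_real_derivative d) (at (u x))"
  shows "partial_deriv i (\<lambda>x. F (u x)) x = d * partial_deriv i u x"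
    and "(\<lambda>x. F (u x)) differentiable (at x)"
proof -
  have *: "((\<lambda>x. F (u x)) has_derivative (\<lambda>h. d * frechet_derivative u (at x) h)) (at x)"
    using has_derivative_compose[OF assms(1)[unfolded frechet_derivative_works]
        assms(2)[unfolded has_field_derivative_def]] by simp
  then show "(\<lambda>x. F (u x)) differentiable (at x)"
    by (rule differentiableI)
  show "partial_deriv i (\<lambda>x. F (u x)) x = d * partial_deriv i u x"
    by (subst partial_deriv_eq[OF *]) (simp add: partial_deriv_def)
qed

lemma Ck_add: "Ck k u \<Longrightarrow> Ck k v \<Longrightarrow> Ck k (\<lambda>x. u x + v x)"
proof (induction k arbitrary: u v)
  case (Suc k)
  have "partial_deriv i (\<lambda>x. u x + v x) = (\<lambda>x. partial_deriv i u x + partial_deriv i v x)" for i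
    using Suc.prems by (intro ext partial_deriv_add) auto
  with Suc show ?case by simp
qed (simp add: continuous_on_add)

lemma Ck_mult: "Ck k u \<Longrightarrow> Ck k v \<Longrightarrow> Ck k (\<lambda>x. u x * v x)"
proof (induction k arbitrary: u v)
  case (Suc k)
  have "partial_deriv i (\<lambda>x. u x * v x)
      = (\<lambda>x. u x * partial_deriv i v x + partial_deriv i u x * v x)" for i
    using Suc.prems by (intro ext partial_deriv_mult) auto
  moreover have "Ck k u" "Ck k v"
    using Suc.prems by (auto dest: Ck_Suc_imp_Ck simp del: Ck.simps)
  ultimately show ?case
    using Suc by (simp add: Ck_add)
qed (simp add: continuous_on_mult)

text \<open>
  The exponent is generalized because differentiation lowers it; positivity of the base keeps the
  real power smooth.
\<close>

lemma Ck_powr: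
  assumes "Ck k u" "\<And>x. 0 < u x"
  shows "Ck k (\<lambda>x. u x powr a)"
  using assms
proof (induction k arbitrary: u a)
  case 0
  then show ?case by (auto intro!: continuous_intros) (metis less_irrefl)
next
  case (Suc k)
  have D: "((\<lambda>y. y powr a) has_real_derivative (a * u x powr (a - 1))) (at (u x))" for x
    using Suc.prems(2)[of x] by (auto intro!: derivative_eq_intros simp: field_simps powr_diff)
  have du: "u differentiable (at x)" for x
    using Suc.prems(1) by simp
  have "partial_deriv i (\<lambda>x. u x powr a) = (\<lambda>x. a * u x powr (a - 1) * partial_deriv i u x)" for i
    by (intro ext partial_deriv_chain(1) du D)
  moreover have "(\<lambda>x. u x powr a) differentiable (at x)" for x
    by (rule partial_deriv_chain(2)[OF du D])
  moreover have "Ck k (\<lambda>x. u x powr (a - 1))"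
    using Suc.prems Ck_Suc_imp_Ck by (intro Suc.IH) auto
  ultimately show ?case
    using Suc.prems by (simp add: Ck_mult Ck_const)
qed

lemma Ck_sqrt: "Ck k u \<Longrightarrow> (\<And>x. 0 < u x) \<Longrightarrow> Ck k (\<lambda>x. sqrt (u x))"
  using Ck_powr[of k u "1/2"] by (simp add: powr_half_sqrt less_imp_le)

section \<open>A smooth truncation of the real line\<close>

text \<open>
  The truncation of \<open>y\<close> to \<open>[-1, 1]\<close> equals \<open>(\<bar>y + 1\<bar> - \<bar>y - 1\<bar>) / 2\<close>. Replacing each \<open>\<bar>a\<bar>\<close> by
  \<open>sqrt (a\<^sup>2 + \<eta>\<^sup>2)\<close> makes it smooth while keeping what matters about it: it fixes \<open>0\<close>, so that supports
  do not grow; its values lie in \<open>[-1, 1]\<close>; and it is 1-Lipschitz.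
\<close>

definition soft_clip :: "real \<Rightarrow> real \<Rightarrow> real" where
  "soft_clip \<eta> y = (sqrt ((y + 1)\<^sup>2 + \<eta>\<^sup>2) - sqrt ((y - 1)\<^sup>2 + \<eta>\<^sup>2)) / 2"

definition soft_clip' :: "real \<Rightarrow> real \<Rightarrow> real" where
  "soft_clip' \<eta> y = ((y + 1) / sqrt ((y + 1)\<^sup>2 + \<eta>\<^sup>2) - (y - 1) / sqrt ((y - 1)\<^sup>2 + \<eta>\<^sup>2)) / 2"

lemma soft_clip_zero: "soft_clip \<eta> 0 = 0"
  by (simp add: soft_clip_def)

lemma soft_clip_deriv:
  assumes "\<eta> > 0"
  shows "(soft_clip \<eta> has_real_derivative soft_clip' \<eta> y) (at y)"
proof -
  have "((\<lambda>y. sqrt ((y + c)\<^sup>2 + \<eta>\<^sup>2)) has_real_derivative (y + c) / sqrt ((y + c)\<^sup>2 + \<eta>\<^sup>2)) (at y)" for c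
  proof -
    have "(y + c)\<^sup>2 + \<eta>\<^sup>2 > 0"
      using assms by (simp add: add_nonneg_pos)
    then show ?thesis
      by (auto intro!: derivative_eq_intros simp: divide_simps)
  qed
  from DERIV_cdivide[OF DERIV_diff[OF this[of 1] this[of "-1"]], of 2] show ?thesis
    by (simp add: soft_clip_def[abs_def] soft_clip'_def)
qed

lemma abs_soft_clip'_le_1: "\<bar>soft_clip' \<eta> y\<bar> \<le> 1"
proof -
  have "\<bar>a / sqrt (a\<^sup>2 + \<eta>\<^sup>2)\<bar> \<le> 1" for a :: real
    unfolding abs_divide
    by (rule divide_le_eq_1[THEN iffD2]) (auto simp: not_sum_power2_lt_zero
        intro!: real_le_rsqrt sum_power2_gt_zero_iff[THEN iffD2])
  from this[of "y + 1"] this[of "y - 1"] show ?thesis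
    unfolding soft_clip'_def abs_le_iff by auto
qed

text \<open>
  The two square roots are the Euclidean lengths of \<open>(y + 1, \<eta>)\<close> and \<open>(y - 1, \<eta>)\<close>, and these two
  vectors differ by \<open>(2, 0)\<close>.
\<close>

lemma abs_soft_clip_le_1: "\<bar>soft_clip \<eta> y\<bar> \<le> 1"
proof -
  have "sqrt ((a + b)\<^sup>2 + (\<eta> + 0)\<^sup>2) \<le> sqrt (a\<^sup>2 + \<eta>\<^sup>2) + sqrt (b\<^sup>2 + 0\<^sup>2)" for a b :: real
    by (rule real_sqrt_sum_squares_triangle_ineq)
  from this[of "y + 1" "-2"] this[of "y - 1" 2] show ?thesis
    unfolding soft_clip_def by (simp add: abs_le_iff field_simps)
qed

text \<open>
  Write \<open>y = v + e * (v - w)\<close>. Where \<open>v\<close> is \<open>1\<close> we have \<open>y \<ge> 1\<close>, and where \<open>v\<close> is \<open>-1\<close> we have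
  \<open>y \<le> -1\<close>, so that truncating \<open>y\<close> leaves the extreme values of \<open>v\<close> in place. The bound is the
  quantitative form of this that survives for values of \<open>v\<close> that are merely close to \<open>1\<close> or \<open>-1\<close>:
  the truncation of \<open>y\<close> is within \<open>e\<close> of \<open>(1 + e) * v\<close>, and smoothing costs at most \<open>\<eta>\<close> more.
\<close>

lemma soft_clip_approx:
  assumes "\<eta> > 0" "\<bar>v\<bar> \<le> 1" "\<bar>w\<bar> \<le> 1" "e > 0"
  shows "\<bar>(1 + e) * v - soft_clip \<eta> ((1 + e) * v - e * w)\<bar> \<le> e + \<eta>"
proof -
  define y where "y = (1 + e) * v - e * w"
  have s: "\<bar>a\<bar> \<le> sqrt (a\<^sup>2 + \<eta>\<^sup>2)" "sqrt (a\<^sup>2 + \<eta>\<^sup>2) \<le> \<bar>a\<bar> + \<eta>" for a :: real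
    using assms(1) by (auto intro!: real_le_rsqrt real_le_lsqrt simp: power2_sum)
  have "e * v \<le> e" "e * w \<le> e" "- e \<le> e * v" "- e \<le> e * w"
    using assms mult_left_mono[of "-1" v e] mult_left_mono[of "-1" w e] by (auto simp: abs_le_iff)
  moreover have "y = v + e * v - e * w"
    by (simp add: y_def distrib_right)
  moreover consider "1 \<le> y" | "y \<le> - 1" | "- 1 \<le> y" "y \<le> 1"
    by linarith
  then have "(\<bar>y + 1\<bar> - \<bar>y - 1\<bar>) / 2 = (if 1 \<le> y then 1 else if y \<le> - 1 then - 1 else y)"
    by cases auto
  ultimately have approx: "\<bar>(1 + e) * v - (\<bar>y + 1\<bar> - \<bar>y - 1\<bar>) / 2\<bar> \<le> e"
    using assms(2) by (auto simp: abs_le_iff distrib_right)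
  have final: "\<bar>X - (P - Q) / 2\<bar> \<le> e + \<eta>"
    if "\<bar>X - (P' - Q') / 2\<bar> \<le> e" "P' \<le> P" "P \<le> P' + \<eta>" "Q' \<le> Q" "Q \<le> Q' + \<eta>" for X P P' Q Q' :: real
    using that assms(1) by (simp add: abs_le_iff field_simps)
  from final[OF approx s s] show ?thesis
    by (simp only: soft_clip_def y_def[symmetric])
qed

lemma Ck_soft_clip:
  assumes "\<eta> > 0" "Ck k u"
  shows "Ck k (\<lambda>x. soft_clip \<eta> (u x))"
proof -
  have "Ck k (\<lambda>x. sqrt ((u x + c) * (u x + c) + \<eta>\<^sup>2))" for c
    using assms
    by (intro Ck_sqrt Ck_add Ck_mult Ck_const) (auto simp: add_nonneg_pos)
  from Ck_mult[OF Ck_add[OF this[of 1] Ck_mult[OF Ck_const[of k "-1"] this[of "-1"]]] Ck_const[of k "1/2"]]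
  show ?thesis
    by (simp add: soft_clip_def power2_eq_square diff_divide_distrib)
qed

section \<open>Test functions and their rotated gradients\<close>

text \<open>
  Test functions without the bound on their values, which form a vector space.
\<close>

definition smooth_supported :: "(real^2) set \<Rightarrow> (real^2 \<Rightarrow> real) set" where
  "smooth_supported \<Omega> = {v. (\<forall>k. Ck k v) \<and> compact (closure {x. v x \<noteq> 0}) \<and>
                              closure {x. v x \<noteq> 0} \<subseteq> \<Omega>}"

lemma test_functions_iff:
  "v \<in> test_functions \<Omega> \<longleftrightarrow> v \<in> smooth_supported \<Omega> \<and> (\<forall>x. \<bar>v x\<bar> \<le> 1)"
proof -
  have "range v \<subseteq> {-1..1} \<longleftrightarrow> (\<forall>x. \<bar>v x\<bar> \<le> 1)"
    by (force simp: image_subset_iff abs_le_iff)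
  then show ?thesis
    unfolding test_functions_def smooth_supported_def by simp
qed

lemma smooth_supported_differentiable:
  assumes "v \<in> smooth_supported \<Omega>"
  shows "v differentiable (at x)"
proof -
  have "Ck (Suc 0) v"
    using assms unfolding smooth_supported_def by blast
  then show ?thesis by simp
qed

lemma smooth_supportedI:
  assumes "\<And>k. Ck k z" "v \<in> smooth_supported \<Omega>" "w \<in> smooth_supported \<Omega>"
    and zero: "\<And>x. v x = 0 \<Longrightarrow> w x = 0 \<Longrightarrow> z x = 0"
  shows "z \<in> smooth_supported \<Omega>"
proof -
  let ?K = "closure {x. v x \<noteq> 0} \<union> closure {x. w x \<noteq> 0}"
  have sub: "closure {x. z x \<noteq> 0} \<subseteq> ?K"
    unfolding closure_Un[symmetric] using zero by (intro closure_mono) blast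
  moreover have "compact ?K" "?K \<subseteq> \<Omega>"
    using assms(2,3) unfolding smooth_supported_def by (blast intro: compact_Un)+
  moreover from this(1) have "compact (closure {x. z x \<noteq> 0})"
    using compact_Int_closed[OF _ closed_closure, of ?K "{x. z x \<noteq> 0}"] sub by (simp add: Int_absorb1)
  ultimately show ?thesis
    using assms(1) unfolding smooth_supported_def by blast
qed

lemma smooth_supported_lincomb:
  assumes "v \<in> smooth_supported \<Omega>" "w \<in> smooth_supported \<Omega>"
  shows "(\<lambda>x. a * v x + b * w x) \<in> smooth_supported \<Omega>"
proof (rule smooth_supportedI[OF _ assms])
  show "Ck k (\<lambda>x. a * v x + b * w x)" for k
    using assms by (intro Ck_add Ck_mult Ck_const) (auto simp: smooth_supported_def)
qed simp

lemma test_functions_convex: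
  assumes "v \<in> test_functions \<Omega>" "w \<in> test_functions \<Omega>" "0 \<le> a" "0 \<le> b" "a + b = 1"
  shows "(\<lambda>x. a * v x + b * w x) \<in> test_functions \<Omega>"
proof -
  have "\<bar>a * v x + b * w x\<bar> \<le> 1" for x
  proof -
    have "\<bar>a * v x + b * w x\<bar> \<le> a * \<bar>v x\<bar> + b * \<bar>w x\<bar>"
      using assms(3,4) by (intro order_trans[OF abs_triangle_ineq]) (simp add: abs_mult)
    also have "\<dots> \<le> 1"
      using assms by (intro convex_bound_le) (auto simp: test_functions_iff)
    finally show ?thesis .
  qed
  with assms(1,2) show ?thesis
    by (simp add: test_functions_iff smooth_supported_lincomb)
qed

lemma zero_test_function: "(\<lambda>x. 0) \<in> test_functions \<Omega>"
  by (simp add: test_functions_def Ck_const)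

lemma grad_perp_eq:
  "grad_perp v x = partial_deriv 2 v x *\<^sub>R axis 1 1 - partial_deriv 1 v x *\<^sub>R axis 2 1"
  by (simp add: grad_perp_def vec_eq_iff forall_2 axis_def)

lemma grad_perp_lincomb:
  assumes "v \<in> smooth_supported \<Omega>" "w \<in> smooth_supported \<Omega>"
  shows "grad_perp (\<lambda>x. a * v x + b * w x) = (\<lambda>x. a *\<^sub>R grad_perp v x + b *\<^sub>R grad_perp w x)"
proof -
  have "partial_deriv i (\<lambda>x. a * v x + b * w x) x = a * partial_deriv i v x + b * partial_deriv i w x"
    for i x
  proof -
    note D = smooth_supported_differentiable[OF assms(1), of x, unfolded frechet_derivative_works]
      smooth_supported_differentiable[OF assms(2), of x, unfolded frechet_derivative_works]
    show ?thesis
      by (subst partial_deriv_eq[OF has_derivative_add[OF D[THEN has_derivative_mult_right]]])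
        (simp add: partial_deriv_def)
  qed
  then show ?thesis
    by (simp add: fun_eq_iff grad_perp_eq algebra_simps)
qed

lemma grad_perp_zero: "grad_perp (\<lambda>x. 0) = (\<lambda>x. 0)"
proof -
  have "partial_deriv i (\<lambda>x. 0) x = 0" for i x
    by (subst partial_deriv_eq[OF has_derivative_const]) simp
  then show ?thesis
    by (simp add: fun_eq_iff grad_perp_eq)
qed

text \<open>
  The field is continuous and vanishes off the compact support of \<open>v\<close>, so it is bounded; and
  \<open>\<Omega>\<close> has finite measure.
\<close>

lemma grad_perp_L2:
  assumes \<Omega>: "\<Omega> \<in> lmeasurable" and v: "v \<in> smooth_supported \<Omega>"
  shows "grad_perp v \<in> L2 \<Omega>"
proof -
  interpret finite_measure "lebesgue_on \<Omega>"
    by (rule finite_measure_lebesgue_on[OF \<Omega>])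
  let ?K = "closure {x. v x \<noteq> 0}"
  have "Ck (Suc 0) v"
    using v by (simp add: smooth_supported_def del: Ck.simps)
  then have cont: "continuous_on UNIV (grad_perp v)"
    unfolding grad_perp_eq[abs_def] by (intro continuous_intros) auto
  have off: "grad_perp v x = 0" if "x \<notin> ?K" for x
  proof -
    have "(v has_derivative (\<lambda>h. 0)) (at x)"
    proof (rule has_derivative_transform_within_open[of "\<lambda>x. 0" _ _ _ "- ?K"])
      show "0 = v y" if "y \<in> - ?K" for y
        using that closure_subset[of "{x. v x \<noteq> 0}"] by auto
    qed (use that in auto)
    then have "partial_deriv i v x = 0" for i
      by (simp add: partial_deriv_eq)
    then show ?thesis by (simp add: grad_perp_eq)
  qed
  have "compact (grad_perp v ` ?K)"
    using v by (intro compact_continuous_image continuous_on_subset[OF cont])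
      (auto simp: smooth_supported_def)
  from compact_imp_bounded[OF this] obtain B
    where B: "\<And>x. x \<in> ?K \<Longrightarrow> norm (grad_perp v x) \<le> B"
    unfolding bounded_iff by blast
  have "norm (grad_perp v x) \<le> max B 0" for x
    using B[of x] off[of x] by (cases "x \<in> ?K") auto
  then have "(norm (grad_perp v x))\<^sup>2 \<le> (max B 0)\<^sup>2" for x
    by (intro power_mono) auto
  moreover have meas: "grad_perp v \<in> borel_measurable (lebesgue_on \<Omega>)"
    using \<Omega> by (intro continuous_imp_measurable_on_sets_lebesgue continuous_on_subset[OF cont])
      (auto simp: fmeasurableD)
  ultimately have "integrable (lebesgue_on \<Omega>) (\<lambda>x. (norm (grad_perp v x))\<^sup>2)"
    by (intro integrable_const_bound[where B = "(max B 0)\<^sup>2"]) auto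
  with meas show ?thesis
    by (simp add: L2_def)
qed

lemma test_function_smooth: "v \<in> test_functions \<Omega> \<Longrightarrow> v \<in> smooth_supported \<Omega>"
  by (simp add: test_functions_iff)

lemmas grad_perp_test_L2 = grad_perp_L2[OF _ test_function_smooth]

section \<open>The total variation of the rotation and its near-maximizers\<close>

lemma J_rot_upper: "v \<in> test_functions \<Omega> \<Longrightarrow> ereal (l2_inner \<Omega> u (grad_perp v)) \<le> J_rot \<Omega> u"
  unfolding J_rot_def by (rule SUP_upper)

lemma J_rot_nonneg: "0 \<le> J_rot \<Omega> u"
  using J_rot_upper[OF zero_test_function, of \<Omega> u]
  by (simp add: grad_perp_zero l2_inner_def zero_ereal_def)

text \<open>
  By homogeneity, finiteness of \<open>J_rot\<close> at \<open>u\<close> bounds the distribution \<open>rot u\<close> by the supremum norm: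
  \<open>rot u\<close> is a measure of total variation \<open>j\<close>. The inequality stands in for this measure
  in what follows.
\<close>

lemma J_rot_bound:
  assumes "J_rot \<Omega> u = ereal j" "\<phi> \<in> smooth_supported \<Omega>" "\<And>x. \<bar>\<phi> x\<bar> \<le> \<eta>" "0 < \<eta>"
  shows "l2_inner \<Omega> u (grad_perp \<phi>) \<le> \<eta> * j"
proof -
  have "(\<lambda>x. (1 / \<eta>) * \<phi> x + 0 * \<phi> x) \<in> test_functions \<Omega>"
    using assms smooth_supported_lincomb[OF assms(2,2), of "1 / \<eta>" 0]
    by (simp add: test_functions_iff)
  from J_rot_upper[OF this, of u] have "(1 / \<eta>) * l2_inner \<Omega> u (grad_perp \<phi>) \<le> j"
    unfolding grad_perp_lincomb[OF assms(2,2)] assms(1) by (simp add: l2_inner_linear)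
  with \<open>0 < \<eta>\<close> show ?thesis
    by (simp add: field_simps)
qed

text \<open>
  The truncation \<open>z\<close> of \<open>v + e * (v - w)\<close>. Its gradient is no larger than that of the untruncated
  function, because the truncation is 1-Lipschitz; and by the closeness to \<open>(1 + e) * v\<close> it pairs with
  \<open>rot u\<close> almost as well as \<open>v\<close> does when \<open>v\<close> is nearly a maximizer.
\<close>

lemma truncated_test_function:
  assumes v: "v \<in> test_functions \<Omega>" and w: "w \<in> test_functions \<Omega>" and "0 < e" "0 < \<eta>"
  obtains z where "z \<in> test_functions \<Omega>"
    "\<And>x. norm (grad_perp z x) \<le> norm ((1 + e) *\<^sub>R grad_perp v x - e *\<^sub>R grad_perp w x)"
    "\<And>x. \<bar>(1 + e) * v x - z x\<bar> \<le> e + \<eta>"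
proof -
  define y where "y = (\<lambda>x. (1 + e) * v x + (- e) * w x)"
  define z where "z = (\<lambda>x. soft_clip \<eta> (y x))"
  note vw = v[THEN test_function_smooth] w[THEN test_function_smooth]
  have y: "y \<in> smooth_supported \<Omega>"
    unfolding y_def by (rule smooth_supported_lincomb[OF vw])
  have z: "z \<in> smooth_supported \<Omega>"
  proof (rule smooth_supportedI[OF _ y y])
    show "Ck k z" for k
      unfolding z_def using y \<open>0 < \<eta>\<close> by (intro Ck_soft_clip) (auto simp: smooth_supported_def)
  qed (simp add: z_def soft_clip_zero)
  have "partial_deriv i z x = soft_clip' \<eta> (y x) * partial_deriv i y x" for i x
    unfolding z_def using smooth_supported_differentiable[OF y] soft_clip_deriv[OF \<open>0 < \<eta>\<close>]
    by (rule partial_deriv_chain(1))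
  then have gz: "grad_perp z x = soft_clip' \<eta> (y x) *\<^sub>R grad_perp y x" for x
    by (simp add: grad_perp_eq algebra_simps)
  show thesis
  proof
    show "z \<in> test_functions \<Omega>"
      using z by (simp add: test_functions_iff z_def abs_soft_clip_le_1)
    show "norm (grad_perp z x) \<le> norm ((1 + e) *\<^sub>R grad_perp v x - e *\<^sub>R grad_perp w x)" for x
    proof -
      have "norm (grad_perp z x) \<le> 1 * norm (grad_perp y x)"
        unfolding gz norm_scaleR by (intro mult_right_mono abs_soft_clip'_le_1) simp
      then show ?thesis
        unfolding y_def grad_perp_lincomb[OF vw] by simp
    qed
    show "\<bar>(1 + e) * v x - z x\<bar> \<le> e + \<eta>" for x
      using soft_clip_approx[of \<eta> "v x" "w x" e] v w assms(3,4)
      by (simp add: z_def y_def test_functions_iff)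
  qed
qed

section \<open>Subgradients of minimal norm\<close>

text \<open>
  \<open>J_rot\<close> is the support function of the convex set of fields \<open>grad_perp v\<close>, so by the Hahn-Banach
  theorem a field that is dominated by \<open>J_rot\<close> lies in the closure of that set. In a Hilbert space the
  separating functional is given by the projection: \<open>g\<close> below is the element of minimal norm in the
  closure of the translated set \<open>A\<close>.
\<close>

lemma approx_by_grad_perp:
  assumes \<Omega>: "\<Omega> \<in> lmeasurable" and p: "p \<in> L2 \<Omega>"
    and le: "\<And>v. v \<in> L2 \<Omega> \<Longrightarrow> ereal (l2_inner \<Omega> p v) \<le> J_rot \<Omega> v"
  obtains v where "\<And>n. v n \<in> test_functions \<Omega>"
    "(\<lambda>n. l2_norm \<Omega> (\<lambda>x. grad_perp (v n) x - p x)) \<longlonglongrightarrow> 0"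
proof -
  define A where "A = (\<lambda>v x. grad_perp v x - p x) ` test_functions \<Omega>"
  have A_L2: "A \<subseteq> L2 \<Omega>"
    using p by (auto simp: A_def intro!: L2_diff grad_perp_test_L2[OF \<Omega>])
  have A_convex: "(\<lambda>x. s *\<^sub>R a x + t *\<^sub>R b x) \<in> A"
    if "a \<in> A" "b \<in> A" "0 \<le> s" "0 \<le> t" "s + t = 1" for a b s t
  proof -
    obtain v w where vw: "v \<in> test_functions \<Omega>" "w \<in> test_functions \<Omega>"
      "a = (\<lambda>x. grad_perp v x - p x)" "b = (\<lambda>x. grad_perp w x - p x)"
      using \<open>a \<in> A\<close> \<open>b \<in> A\<close> by (auto simp: A_def)
    have "s *\<^sub>R a x + t *\<^sub>R b x = grad_perp (\<lambda>x. s * v x + t * w x) x - p x" for x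
    proof -
      have "s *\<^sub>R p x + t *\<^sub>R p x = p x"
        using \<open>s + t = 1\<close> by (simp flip: scaleR_add_left)
      then show ?thesis
        unfolding grad_perp_lincomb[OF vw(1,2)[THEN test_function_smooth]] vw(3,4)
        by (simp add: algebra_simps)
    qed
    with test_functions_convex[OF vw(1,2) that(3-5)] show ?thesis
      by (auto simp: A_def fun_eq_iff)
  qed
  have A_mid: "(\<lambda>x. (1 / 2) *\<^sub>R (a x + b x)) \<in> A" if "a \<in> A" "b \<in> A" for a b
    using A_convex[OF that, of "1/2" "1/2"] by (simp add: scaleR_add_right)
  have "(\<lambda>x. grad_perp (\<lambda>x. 0) x - p x) \<in> A"
    unfolding A_def by (rule imageI[OF zero_test_function])
  then have "\<exists>a\<in>A. l2_norm \<Omega> a \<le> l2_norm \<Omega> (\<lambda>x. grad_perp (\<lambda>x. 0) x - p x)"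
    by blast
  from nested_convex_minimizer[of \<Omega> "\<lambda>n. A", OF \<Omega> A_L2 order_refl A_mid this]
  obtain g c where g: "g \<in> L2 \<Omega>" and c: "\<And>n. c n \<in> A"
    and lim: "(\<lambda>n. l2_norm \<Omega> (\<lambda>x. c n x - g x)) \<longlonglongrightarrow> 0"
    and g_min: "\<And>\<beta>. (\<And>n :: nat. \<exists>a\<in>A. l2_norm \<Omega> a \<le> \<beta>) \<Longrightarrow> l2_norm \<Omega> g \<le> \<beta>"
    by blast
  have min: "l2_norm \<Omega> g \<le> l2_norm \<Omega> a" if "a \<in> A" for a
    using that by (intro g_min) blast
  have cL2: "c n \<in> L2 \<Omega>" for n
    using A_L2 c by blast
  have var: "0 \<le> l2_inner \<Omega> g (\<lambda>x. a x - g x)" if a: "a \<in> A" for a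
  proof (rule l2_inner_nonneg_of_minimal[OF g])
    have aL2: "a \<in> L2 \<Omega>"
      using a A_L2 by blast
    then show "(\<lambda>x. a x - g x) \<in> L2 \<Omega>"
      by (rule L2_diff[OF _ g])
    fix t :: real assume t: "0 < t" "t \<le> 1"
    have "(\<lambda>n. l2_norm \<Omega> (\<lambda>x. (1 - t) *\<^sub>R c n x + t *\<^sub>R a x))
        \<longlonglongrightarrow> l2_norm \<Omega> (\<lambda>x. (1 - t) *\<^sub>R g x + t *\<^sub>R a x)"
    proof (rule l2_norm_tendsto)
      show "(\<lambda>n. l2_norm \<Omega> (\<lambda>x. ((1 - t) *\<^sub>R c n x + t *\<^sub>R a x) - ((1 - t) *\<^sub>R g x + t *\<^sub>R a x)))
          \<longlonglongrightarrow> 0"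
        using tendsto_mult_right_zero[OF lim, of "\<bar>1 - t\<bar>"]
        by (simp add: l2_norm_scaleR flip: scaleR_diff_right)
    qed (use cL2 g aL2 in \<open>auto intro!: L2_intros\<close>)
    moreover have "l2_norm \<Omega> g \<le> l2_norm \<Omega> (\<lambda>x. (1 - t) *\<^sub>R c n x + t *\<^sub>R a x)" for n
      using t by (intro min A_convex c a) auto
    ultimately have "l2_norm \<Omega> g \<le> l2_norm \<Omega> (\<lambda>x. (1 - t) *\<^sub>R g x + t *\<^sub>R a x)"
      by (intro LIMSEQ_le_const) auto
    then show "l2_norm \<Omega> g \<le> l2_norm \<Omega> (\<lambda>x. g x + t *\<^sub>R (a x - g x))"
      by (simp add: algebra_simps)
  qed
  \<comment> \<open>The variational inequality says that \<open>- g\<close> separates \<open>p\<close> from the fields \<open>grad_perp v\<close>, which is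
    only compatible with the hypothesis on \<open>p\<close> if \<open>g\<close> has norm \<open>0\<close>.\<close>
  have "J_rot \<Omega> (\<lambda>x. - g x) \<le> ereal (- l2_inner \<Omega> g p - l2_inner \<Omega> g g)"
    unfolding J_rot_def
  proof (rule SUP_least)
    fix v assume v: "v \<in> test_functions \<Omega>"
    have "0 \<le> l2_inner \<Omega> g (\<lambda>x. (grad_perp v x - p x) - g x)"
      using v by (intro var) (auto simp: A_def)
    then show "ereal (l2_inner \<Omega> (\<lambda>x. - g x) (grad_perp v))
        \<le> ereal (- l2_inner \<Omega> g p - l2_inner \<Omega> g g)"
      using grad_perp_test_L2[OF \<Omega> v] g p by (simp add: l2_inner_linear L2_intros)
  qed
  from order_trans[OF le[OF L2_minus[OF g]] this] have "l2_inner \<Omega> g g \<le> 0"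
    by (simp add: l2_inner_minus_right l2_inner_commute[of \<Omega> g p])
  then have g0: "l2_norm \<Omega> g = 0"
    using l2_norm_nonneg[of \<Omega> g] by (simp flip: l2_norm_power2)
  have "(\<lambda>n. l2_norm \<Omega> (c n)) \<longlonglongrightarrow> 0"
    using l2_norm_tendsto[OF cL2 g lim] g0 by simp
  moreover have "\<forall>n. \<exists>v. v \<in> test_functions \<Omega> \<and> c n = (\<lambda>x. grad_perp v x - p x)"
    using c unfolding A_def by blast
  then obtain v where "\<And>n. v n \<in> test_functions \<Omega>" "\<And>n. c n = (\<lambda>x. grad_perp (v n) x - p x)"
    by metis
  ultimately show thesis
    using that[of v] by simp
qed

text \<open>
  The elements of the subdifferential at \<open>u\<close> are the limits of fields \<open>grad_perp v\<close> along which the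
  pairing with \<open>u\<close> tends to its supremum \<open>j\<close>. The sets \<open>A n\<close> consist of the nearly maximizing fields.
  Truncation produces, for every test function \<open>w\<close> and every \<open>e > 0\<close>, elements of each \<open>A n\<close> whose norm
  is at most that of \<open>p + e * (p - grad_perp w)\<close>, up to an arbitrarily small error. These elements
  have no evident strong limit, but the norm-minimal sequence through the sets \<open>A n\<close> does: its limit
  \<open>g\<close> is a subgradient at \<open>u\<close> whose norm obeys the same bounds. As \<open>p\<close> is minimal,
  \<open>p\<close> is no longer than \<open>p + e * (p - grad_perp w)\<close> either, and \<open>e \<rightarrow> 0\<close> gives
  \<open>\<langle>p, grad_perp w\<rangle> \<le> \<langle>p, p\<rangle>\<close>, that is, \<open>J_rot p \<le> \<langle>p, p\<rangle>\<close>.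
\<close>

lemma minimal_subgradient_eigenvector:
  assumes \<Omega>: "\<Omega> \<in> lmeasurable" and u: "u \<in> L2 \<Omega>" and p: "p \<in> subdiff \<Omega> (J_rot \<Omega>) u"
    and min: "\<And>q. q \<in> subdiff \<Omega> (J_rot \<Omega>) u \<Longrightarrow> l2_norm \<Omega> p \<le> l2_norm \<Omega> q"
  shows "p \<in> subdiff \<Omega> (J_rot \<Omega>) p"
proof -
  have pL2: "p \<in> L2 \<Omega>" and p_le: "\<And>v. v \<in> L2 \<Omega> \<Longrightarrow> ereal (l2_inner \<Omega> p v) \<le> J_rot \<Omega> v"
    using p by (auto simp: subdiff_def)
  define j where "j = l2_inner \<Omega> p u"
  have J: "J_rot \<Omega> u = ereal j"
    using p by (simp add: subdiff_def j_def)
  have j0: "0 \<le> j"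
    using J_rot_nonneg[of \<Omega> u] J by simp
  note gL2 = grad_perp_test_L2[OF \<Omega>]
  obtain v where v: "\<And>n. v n \<in> test_functions \<Omega>"
    and v_lim: "(\<lambda>n. l2_norm \<Omega> (\<lambda>x. grad_perp (v n) x - p x)) \<longlonglongrightarrow> 0"
    using approx_by_grad_perp[OF \<Omega> pL2 p_le] by blast
  have v_J: "(\<lambda>n. l2_inner \<Omega> (grad_perp (v n)) u) \<longlonglongrightarrow> j"
    unfolding j_def by (rule l2_inner_tendsto[OF gL2[OF v] pL2 u v_lim])
  define A where "A n = {a \<in> grad_perp ` test_functions \<Omega>. j - 1 / real (Suc n) \<le> l2_inner \<Omega> a u}"
    for n
  have A_L2: "A n \<subseteq> L2 \<Omega>" for n
    by (auto simp: A_def gL2)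
  have A_dec: "A n \<subseteq> A m" if "m \<le> n" for m n
  proof -
    have "1 / real (Suc n) \<le> 1 / real (Suc m)"
      using that by (simp add: frac_le)
    then show ?thesis
      unfolding A_def by auto
  qed
  have A_mid: "(\<lambda>x. (1 / 2) *\<^sub>R (a x + b x)) \<in> A n" if ab: "a \<in> A n" "b \<in> A n" for n a b
  proof -
    obtain z z' where z: "z \<in> test_functions \<Omega>" "z' \<in> test_functions \<Omega>"
      "a = grad_perp z" "b = grad_perp z'"
      using ab by (auto simp: A_def)
    have "(\<lambda>x. (1 / 2) *\<^sub>R (a x + b x)) = grad_perp (\<lambda>x. (1 / 2) * z x + (1 / 2) * z' x)"
      unfolding grad_perp_lincomb[OF z(1,2)[THEN test_function_smooth]] z(3,4)
      by (simp add: scaleR_add_right)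
    moreover have "(\<lambda>x. (1 / 2) * z x + (1 / 2) * z' x) \<in> test_functions \<Omega>"
      by (rule test_functions_convex[OF z(1,2)]) auto
    moreover have "j - 1 / real (Suc n) \<le> l2_inner \<Omega> (\<lambda>x. (1 / 2) *\<^sub>R (a x + b x)) u"
    proof -
      have "a \<in> L2 \<Omega>" "b \<in> L2 \<Omega>" "j - 1 / real (Suc n) \<le> l2_inner \<Omega> a u"
        "j - 1 / real (Suc n) \<le> l2_inner \<Omega> b u"
        using ab A_L2 by (auto simp: A_def)
      with u show ?thesis
        unfolding l2_inner_scaleR_left by (simp add: l2_inner_add_left field_simps)
    qed
    ultimately show ?thesis
      unfolding A_def by blast
  qed
  have in_A: "\<forall>\<^sub>F k in sequentially. grad_perp (z k) \<in> A n"
    if "\<And>k. z k \<in> test_functions \<Omega>" "\<forall>\<^sub>F k in sequentially. j - 1 / real (Suc n) < l2_inner \<Omega> (grad_perp (z k)) u"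
    for z n
    using that(2) by eventually_elim (use that(1) in \<open>auto simp: A_def intro: less_imp_le\<close>)
  have norm_A: "\<exists>a\<in>A n. l2_norm \<Omega> a \<le> l2_norm \<Omega> (\<lambda>x. p x + e *\<^sub>R (p x - grad_perp w x)) + \<delta>"
    if w: "w \<in> test_functions \<Omega>" and e: "0 < e" and \<delta>: "0 < \<delta>" for w e \<delta> n
  proof -
    let ?m = "1 / real (Suc n)"
    \<comment> \<open>The smoothing parameter is chosen such that its cost \<open>\<eta> * j\<close> stays below the tolerance \<open>?m\<close> of \<open>A n\<close>;
      the summand \<open>1\<close> covers the case \<open>j = 0\<close>.\<close>
    define \<eta> where "\<eta> = ?m / (2 * (j + 1))"
    have \<eta>: "0 < \<eta>" "\<eta> * j < ?m"
    proof -
      show "0 < \<eta>"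
        using j0 by (simp add: \<eta>_def)
      have "?m * j < ?m * (2 * (j + 1))"
        using j0 by (intro mult_strict_left_mono) auto
      then show "\<eta> * j < ?m"
        using j0 by (simp add: \<eta>_def divide_simps)
    qed
    have "\<exists>z. z \<in> test_functions \<Omega> \<and>
        (\<forall>x. norm (grad_perp z x) \<le> norm ((1 + e) *\<^sub>R grad_perp (v k) x - e *\<^sub>R grad_perp w x)) \<and>
        (\<forall>x. \<bar>(1 + e) * v k x - z x\<bar> \<le> e + \<eta>)" for k
      by (rule truncated_test_function[OF v[of k] w e \<eta>(1)]) blast
    then obtain z where z: "\<And>k. z k \<in> test_functions \<Omega>"
      and z_norm: "\<And>k x. norm (grad_perp (z k) x)
          \<le> norm ((1 + e) *\<^sub>R grad_perp (v k) x - e *\<^sub>R grad_perp w x)"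
      and z_close: "\<And>k x. \<bar>(1 + e) * v k x - z k x\<bar> \<le> e + \<eta>"
      by metis
    \<comment> \<open>\<open>(1 + e) * v k - z k\<close> is a function bounded by \<open>e + \<eta>\<close>, so its pairing is at most \<open>(e + \<eta>) * j\<close>.\<close>
    have z_J: "(1 + e) * l2_inner \<Omega> (grad_perp (v k)) u - (e + \<eta>) * j \<le> l2_inner \<Omega> (grad_perp (z k)) u" for k
    proof -
      note sm = v[of k, THEN test_function_smooth] z[of k, THEN test_function_smooth]
      have "l2_inner \<Omega> u (grad_perp (\<lambda>x. (1 + e) * v k x + (- 1) * z k x)) \<le> (e + \<eta>) * j"
        using z_close e \<eta>(1) by (intro J_rot_bound[OF J smooth_supported_lincomb[OF sm]]) auto
      then show ?thesis
        unfolding grad_perp_lincomb[OF sm]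
        using gL2[OF v] gL2[OF z] u
        by (simp add: l2_inner_linear L2_intros l2_inner_commute[of \<Omega> u])
    qed
    \<comment> \<open>The terms \<open>e * j\<close> cancel in the limit, as \<open>v k\<close> is a maximizing sequence.\<close>
    have "(\<lambda>k. (1 + e) * l2_inner \<Omega> (grad_perp (v k)) u - (e + \<eta>) * j) \<longlonglongrightarrow> (1 + e) * j - (e + \<eta>) * j"
      by (intro tendsto_intros v_J)
    moreover have "j - ?m < (1 + e) * j - (e + \<eta>) * j"
      using \<eta>(2) by (simp add: algebra_simps)
    ultimately have "\<forall>\<^sub>F k in sequentially. j - ?m < (1 + e) * l2_inner \<Omega> (grad_perp (v k)) u - (e + \<eta>) * j"
      by (rule order_tendstoD)
    then have ev1: "\<forall>\<^sub>F k in sequentially. grad_perp (z k) \<in> A n"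
      using z_J by (intro in_A z) (auto elim!: eventually_mono intro: less_le_trans)
    let ?q = "\<lambda>x. (1 + e) *\<^sub>R p x - e *\<^sub>R grad_perp w x"
    let ?c = "\<lambda>k x. (1 + e) *\<^sub>R grad_perp (v k) x - e *\<^sub>R grad_perp w x"
    have cL2: "?c k \<in> L2 \<Omega>" for k
      by (intro L2_intros gL2 v w)
    have "(\<lambda>k. l2_norm \<Omega> (?c k)) \<longlonglongrightarrow> l2_norm \<Omega> ?q"
    proof (rule l2_norm_tendsto[OF cL2])
      show "?q \<in> L2 \<Omega>"
        by (intro L2_intros gL2 pL2 w)
      show "(\<lambda>k. l2_norm \<Omega> (\<lambda>x. ?c k x - ?q x)) \<longlonglongrightarrow> 0"
        using tendsto_mult_right_zero[OF v_lim, of "\<bar>1 + e\<bar>"]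
        by (simp add: l2_norm_scaleR flip: scaleR_diff_right)
    qed
    then have "\<forall>\<^sub>F k in sequentially. l2_norm \<Omega> (?c k) < l2_norm \<Omega> ?q + \<delta>"
      using \<delta> by (intro order_tendstoD) auto
    from eventually_conj[OF ev1 this]
    obtain k where k: "grad_perp (z k) \<in> A n" "l2_norm \<Omega> (?c k) < l2_norm \<Omega> ?q + \<delta>"
      using eventually_happens'[OF sequentially_bot] by auto
    have "l2_norm \<Omega> (grad_perp (z k)) \<le> l2_norm \<Omega> (?c k)"
      by (intro l2_norm_le_pointwise gL2 z cL2 z_norm)
    moreover have "?q = (\<lambda>x. p x + e *\<^sub>R (p x - grad_perp w x))"
      by (simp add: algebra_simps)
    ultimately show ?thesis
      using k by (intro bexI[OF _ k(1)]) simp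
  qed
  obtain g c where g: "g \<in> L2 \<Omega>" and c: "\<And>n. c n \<in> A n"
    and c_lim: "(\<lambda>n. l2_norm \<Omega> (\<lambda>x. c n x - g x)) \<longlonglongrightarrow> 0"
    and g_min: "\<And>\<beta>. (\<And>n. \<exists>a\<in>A n. l2_norm \<Omega> a \<le> \<beta>) \<Longrightarrow> l2_norm \<Omega> g \<le> \<beta>"
    using nested_convex_minimizer[of \<Omega> A, OF \<Omega> A_L2 A_dec A_mid
        norm_A[OF zero_test_function zero_less_one zero_less_one]] by blast
  have cL2: "c n \<in> L2 \<Omega>" for n
    using A_L2 c by blast
  have g_sub: "g \<in> subdiff \<Omega> (J_rot \<Omega>) u"
  proof -
    have le: "ereal (l2_inner \<Omega> g y) \<le> J_rot \<Omega> y" if y: "y \<in> L2 \<Omega>" for y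
    proof (rule LIMSEQ_le_const2)
      show "(\<lambda>n. ereal (l2_inner \<Omega> (c n) y)) \<longlonglongrightarrow> ereal (l2_inner \<Omega> g y)"
        using l2_inner_tendsto[OF cL2 g y c_lim] by simp
      have "ereal (l2_inner \<Omega> (c n) y) \<le> J_rot \<Omega> y" for n
        using c[of n] J_rot_upper by (auto simp: A_def l2_inner_commute[of \<Omega> _ y])
      then show "\<exists>N. \<forall>n\<ge>N. ereal (l2_inner \<Omega> (c n) y) \<le> J_rot \<Omega> y"
        by blast
    qed
    have "j \<le> l2_inner \<Omega> g u"
    proof (rule LIMSEQ_le)
      show "(\<lambda>n. l2_inner \<Omega> (c n) u) \<longlonglongrightarrow> l2_inner \<Omega> g u"
        by (rule l2_inner_tendsto[OF cL2 g u c_lim])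
      have "(\<lambda>n. j - 1 / real (Suc n)) \<longlonglongrightarrow> j - 0"
        by (intro tendsto_intros LIMSEQ_Suc[OF lim_1_over_n])
      then show "(\<lambda>n. j - 1 / real (Suc n)) \<longlonglongrightarrow> j"
        by simp
      show "\<exists>N. \<forall>n\<ge>N. j - 1 / real (Suc n) \<le> l2_inner \<Omega> (c n) u"
        using c by (auto simp: A_def)
    qed
    with le[OF u] J have "ereal (l2_inner \<Omega> g u) = J_rot \<Omega> u"
      by simp
    with g le show ?thesis
      by (simp add: subdiff_def)
  qed
  have p_var: "l2_inner \<Omega> p (grad_perp w) \<le> l2_inner \<Omega> p p" if w: "w \<in> test_functions \<Omega>" for w
  proof -
    have "0 \<le> l2_inner \<Omega> p (\<lambda>x. p x - grad_perp w x)"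
    proof (rule l2_inner_nonneg_of_minimal[OF pL2 L2_diff[OF pL2 gL2[OF w]]])
      fix e :: real assume e: "0 < e"
      show "l2_norm \<Omega> p \<le> l2_norm \<Omega> (\<lambda>x. p x + e *\<^sub>R (p x - grad_perp w x))"
      proof (rule field_le_epsilon)
        fix \<delta> :: real assume "0 < \<delta>"
        then have "l2_norm \<Omega> g \<le> l2_norm \<Omega> (\<lambda>x. p x + e *\<^sub>R (p x - grad_perp w x)) + \<delta>"
          by (intro g_min norm_A w e)
        with min[OF g_sub]
        show "l2_norm \<Omega> p \<le> l2_norm \<Omega> (\<lambda>x. p x + e *\<^sub>R (p x - grad_perp w x)) + \<delta>"
          by linarith
      qed
    qed
    then show ?thesis
      using pL2 gL2[OF w] by (simp add: l2_inner_linear)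
  qed
  have "J_rot \<Omega> p \<le> ereal (l2_inner \<Omega> p p)"
    unfolding J_rot_def using p_var by (intro SUP_least) simp
  with p_le[OF pL2] have "ereal (l2_inner \<Omega> p p) = J_rot \<Omega> p"
    by (rule antisym)
  with pL2 p_le show ?thesis
    by (simp add: subdiff_def)
qed

theorem theorem5p17:
  fixes \<Omega> :: "(real^2) set"
    and f :: "real^2 \<Rightarrow> real^2"
    and u p :: "real \<Rightarrow> real^2 \<Rightarrow> real^2"
  assumes "open \<Omega>" and "bounded \<Omega>"
    and "f \<in> l2_closure \<Omega> (dom_subdiff \<Omega> (J_rot \<Omega>))"
    and "gradient_flow \<Omega> (J_rot \<Omega>) f u p"
  shows "\<forall>t>0. p t \<in> subdiff \<Omega> (J_rot \<Omega>) (p t)"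
proof (intro allI impI)
  fix t :: real assume t: "0 < t"
  show "p t \<in> subdiff \<Omega> (J_rot \<Omega>) (p t)"
  proof (rule minimal_subgradient_eigenvector)
    show "\<Omega> \<in> lmeasurable"
      using assms(1,2) by (intro lmeasurable_open)
    show "u t \<in> L2 \<Omega>" "p t \<in> subdiff \<Omega> (J_rot \<Omega>) (u t)"
      "\<And>q. q \<in> subdiff \<Omega> (J_rot \<Omega>) (u t) \<Longrightarrow> l2_norm \<Omega> (p t) \<le> l2_norm \<Omega> q"
      using assms(4) t unfolding gradient_flow_def by auto
  qed
qed

end
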